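(* Let $\omega\in\mathbb{R}^m$ and let $L:\mathbb{R}^{M-m}\to\mathbb{R}^{M-m}$ be a (real) linear map with no eigenvalues on the imaginary axis. For any smooth functions ${\bf g}_j,U_j:(\mathbb{R}/2\pi\mathbb{Z})^m\to\mathbb{R}^m$ and $V_j:(\mathbb{R}/2\pi\mathbb{Z})^m\to\mathbb{R}^{M-m}$, there are unique smooth functions ${\bf f}_j:(\mathbb{R}/2\pi\mathbb{Z})^m\to\mathbb{R}^m$ and ${\bf h}_j:(\mathbb{R}/2\pi\mathbb{Z})^m\to\mathbb{R}^{M-m}$ that solve $$\partial_\omega{\bf g}_j+{\bf f}_j=U_j\qquad\text{and}\qquad(\partial_\omega-L)({\bf h}_j)=V_j.$$
   Context: Smooth means $C^\infty$. $\partial_\omega{\bf A}:={\bf A}'\cdot\omega=\frac{d}{ds}|_{s=0}{\bf A}(\cdot+s\omega)$ is the directional derivative in the direction $\omega$. $(\partial_\omega-L)({\bf h})$ denotes the function $\phi\mapsto(\partial_\omega{\bf h})(\phi)-L\cdot{\bf h}(\phi)$. In the paper, $\omega$ is the frequency vector and $L$ the hyperbolic Floquet matrix of a reducible normally hyperbolic (quasi-)periodic invariant torus, and the two equations are called the tangential and normal homological equations. No nonresonance condition on $\omega$ is assumed. *)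

theory Defs
  imports "HOL-Analysis.Analysis"
begin

text \<open>Congruence modulo \<open>2\<pi>\<int>\<^sup>m\<close>; its quotient is the torus \<open>(\<real>/2\<pi>\<int>)\<^sup>m\<close>.\<close>

definition torus_rel :: "real ^ 'm::finite \<Rightarrow> real ^ 'm \<Rightarrow> bool" where
  "torus_rel x y \<longleftrightarrow> (\<forall>i. \<exists>k::int. x $ i - y $ i = 2 * pi * of_int k)"

lemma equivp_torus_rel: "equivp (torus_rel :: real ^ 'm::finite \<Rightarrow> _)"
proof (rule equivpI)
  show "reflp (torus_rel :: real ^ 'm \<Rightarrow> _)"
    by (rule reflpI) (auto simp: torus_rel_def intro: exI[of _ 0])
  show "symp (torus_rel :: real ^ 'm \<Rightarrow> _)"
  proof (rule sympI)
    fix x y :: "real ^ 'm" assume xy: "torus_rel x y"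
    show "torus_rel y x"
      unfolding torus_rel_def
    proof
      fix i
      from xy obtain k :: int where "x $ i - y $ i = 2 * pi * of_int k"
        unfolding torus_rel_def by blast
      then have "y $ i - x $ i = 2 * pi * of_int (- k)"
        by simp
      then show "\<exists>k::int. y $ i - x $ i = 2 * pi * of_int k" ..
    qed
  qed
  show "transp (torus_rel :: real ^ 'm \<Rightarrow> _)"
  proof (rule transpI)
    fix x y z :: "real ^ 'm" assume xy: "torus_rel x y" and yz: "torus_rel y z"
    show "torus_rel x z"
      unfolding torus_rel_def
    proof
      fix i
      from xy obtain k :: int where "x $ i - y $ i = 2 * pi * of_int k"
        unfolding torus_rel_def by blast
      moreover from yz obtain l :: int where "y $ i - z $ i = 2 * pi * of_int l"
        unfolding torus_rel_def by blast
      ultimately have "x $ i - z $ i = 2 * pi * of_int (k + l)"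
        by (simp add: algebra_simps)
      then show "\<exists>k::int. x $ i - z $ i = 2 * pi * of_int k" ..
    qed
  qed
qed

quotient_type 'm torus = "real ^ 'm::finite" / torus_rel
  by (rule equivp_torus_rel)

lift_definition torus_shift :: "'m::finite torus \<Rightarrow> real ^ 'm \<Rightarrow> 'm torus"
  is "\<lambda>x v. x + v"
  by (simp add: torus_rel_def)

text \<open>\<open>C\<^sup>k\<close> on a whole finite-dimensional space: \<open>f\<close> is \<open>C\<^bsup>k+1\<^esup>\<close> if it is Frechet
  differentiable everywhere and \<open>x \<mapsto> Df(x) v\<close> is \<open>C\<^sup>k\<close> for each fixed direction \<open>v\<close>.\<close>

primrec C_k :: "nat \<Rightarrow> ('a::euclidean_space \<Rightarrow> 'b::real_normed_vector) \<Rightarrow> bool" where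
  "C_k 0 f \<longleftrightarrow> continuous_on UNIV f"
| "C_k (Suc k) f \<longleftrightarrow>
     (\<forall>x. f differentiable (at x)) \<and>
     (\<forall>v. C_k k (\<lambda>x. frechet_derivative f (at x) v))"

definition smooth :: "('a::euclidean_space \<Rightarrow> 'b::real_normed_vector) \<Rightarrow> bool" where
  "smooth f \<longleftrightarrow> (\<forall>k. C_k k f)"

text \<open>The quotient map \<open>\<real>\<^sup>m \<rightarrow> (\<real>/2\<pi>\<int>)\<^sup>m\<close> is a local diffeomorphism, so smoothness on the
  torus is smoothness of the lift.\<close>

definition torus_smooth :: "('m::finite torus \<Rightarrow> 'b::real_normed_vector) \<Rightarrow> bool" where
  "torus_smooth A \<longleftrightarrow> smooth (\<lambda>x. A (abs_torus x))"

definition dir_deriv ::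
  "real ^ 'm::finite \<Rightarrow> ('m torus \<Rightarrow> 'b::real_normed_vector) \<Rightarrow> 'm torus \<Rightarrow> 'b" where
  "dir_deriv \<omega> A \<phi> = vector_derivative (\<lambda>s. A (torus_shift \<phi> (s *\<^sub>R \<omega>))) (at 0)"

text \<open>Complex eigenvalues, i.e. eigenvalues of the complexification of the real map \<open>L\<close>.\<close>

definition is_eigenvalue :: "(real ^ 'n::finite \<Rightarrow> real ^ 'n) \<Rightarrow> complex \<Rightarrow> bool" where
  "is_eigenvalue L \<mu> \<longleftrightarrow>
     (\<exists>v :: complex ^ 'n. v \<noteq> 0 \<and>
        (\<chi> i j. complex_of_real (matrix L $ i $ j)) *v v = \<mu> *s v)"

end

theory Submission
  imports Defs "HOL-Computational_Algebra.Fundamental_Theorem_Algebra"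
begin

text \<open>
  The tangential equation is solved by \<open>f = U - \<partial>\<^sub>\<omega>g\<close>. For the normal equation, complexify
  and let \<open>p\<close> be the minimal polynomial of \<open>L\<close>, whose roots are eigenvalues and so lie off
  the imaginary axis. Stripping off one linear factor of \<open>p\<close> at a time reduces both existence
  and uniqueness to the scalar equation \<open>(\<partial>\<^sub>\<omega> - \<mu>) a = u\<close> with \<open>Re \<mu> \<noteq> 0\<close>. For \<open>Re \<mu> > 0\<close> it is solved
  by the Laplace transform \<open>a(x) = - \<integral>\<^sub>0\<^sup>\<infinity> e\<^sup>-\<^sup>\<mu>\<^sup>s u(x + s\<omega>) ds\<close>, which needs no nonresonance condition; the case
  \<open>Re \<mu> < 0\<close> follows on replacing \<open>\<omega>\<close> by \<open>-\<omega>\<close>. Smoothness passes through the integral because the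
  derivatives of \<open>u\<close>, being periodic, are bounded and uniformly continuous. Solutions are unique
  because on the line \<open>x + s\<omega>\<close> a difference of solutions is bounded, while nonzero solutions
  of \<open>y' = \<mu> y\<close> are not.
\<close>

subsection \<open>Smooth and periodic functions\<close>

lemma C_k_imp_continuous_on: "C_k k f \<Longrightarrow> continuous_on UNIV f"
  by (cases k) (auto simp: continuous_on_eq_continuous_at intro: differentiable_imp_continuous_within)

lemma C_k_const: "C_k k (\<lambda>x. c)"
  by (induction k arbitrary: c) auto

text \<open>Directional derivatives of \<open>T (f x)\<close> are \<open>T\<close> applied to those
  of \<open>f\<close>, and the induction hypothesis is applied to these; hence \<open>f\<close> is
  generalized. Uniqueness of derivatives identifies the chosen value
  \<open>frechet_derivative\<close>.\<close>

lemma C_k_bounded_linear: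
  assumes "bounded_linear T" "C_k k f"
  shows "C_k k (\<lambda>x. T (f x))"
  using assms(2)
proof (induction k arbitrary: f)
  case 0
  then show ?case
    using assms(1) by (auto intro: bounded_linear.continuous_on)
next
  case (Suc k)
  have "((\<lambda>y. T (f y)) has_derivative (\<lambda>v. T (frechet_derivative f (at x) v))) (at x)" for x
    using Suc.prems by (intro bounded_linear.has_derivative[OF assms(1)])
      (auto simp: frechet_derivative_works)
  note D = this
  show ?case
    using D Suc by (auto simp: frechet_derivative_at[OF D, symmetric] differentiable_def)
qed

lemma C_k_add:
  assumes "C_k k f" "C_k k g"
  shows "C_k k (\<lambda>x. f x + g x)"
  using assms
proof (induction k arbitrary: f g)
  case 0
  then show ?case by (auto intro: continuous_intros)
next
  case (Suc k)
  have "((\<lambda>y. f y + g y) has_derivative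
      (\<lambda>v. frechet_derivative f (at x) v + frechet_derivative g (at x) v)) (at x)" for x
    using Suc.prems by (intro has_derivative_add) (auto simp: frechet_derivative_works)
  note D = this
  show ?case
    using D Suc by (auto simp: frechet_derivative_at[OF D, symmetric] differentiable_def)
qed

lemma smooth_const: "smooth (\<lambda>x. c)"
  by (simp add: smooth_def C_k_const)

lemma smooth_bounded_linear: "bounded_linear T \<Longrightarrow> smooth f \<Longrightarrow> smooth (\<lambda>x. T (f x))"
  by (simp add: smooth_def C_k_bounded_linear)

lemma smooth_add: "smooth f \<Longrightarrow> smooth g \<Longrightarrow> smooth (\<lambda>x. f x + g x)"
  by (simp add: smooth_def C_k_add)

lemma smooth_diff: "smooth f \<Longrightarrow> smooth g \<Longrightarrow> smooth (\<lambda>x. f x - g x)"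
  using smooth_add[of f "\<lambda>x. - g x"] smooth_bounded_linear[OF bounded_linear_minus[OF bounded_linear_ident]]
  by force

lemma smooth_has_derivative:
  "smooth f \<Longrightarrow> (f has_derivative frechet_derivative f (at x)) (at x)"
  unfolding smooth_def by (metis C_k.simps(2) frechet_derivative_works)

lemma smooth_frechet_derivative: "smooth f \<Longrightarrow> smooth (\<lambda>x. frechet_derivative f (at x) v)"
  unfolding smooth_def by (metis C_k.simps(2))

text \<open>The chain rule that turns the equations into ordinary differential equations on lines in
  the direction \<open>w\<close>.\<close>

lemma has_vector_derivative_along_line:
  assumes "smooth f"
  shows "((\<lambda>s. f (x + s *\<^sub>R w)) has_vector_derivative
    frechet_derivative f (at (x + t *\<^sub>R w)) w) (at t within S)"
proof -
  have "((\<lambda>s. f (x + s *\<^sub>R w)) has_derivative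
      (\<lambda>h. frechet_derivative f (at (x + t *\<^sub>R w)) (h *\<^sub>R w))) (at t)"
    by (rule has_derivative_compose[OF _ smooth_has_derivative[OF assms]])
      (auto intro!: derivative_eq_intros)
  moreover have "linear (frechet_derivative f (at (x + t *\<^sub>R w)))"
    using smooth_has_derivative[OF assms] has_derivative_linear by blast
  ultimately show ?thesis
    by (simp add: has_vector_derivative_def linear_cmul has_derivative_at_withinI)
qed

section \<open>Periodic functions as lifts of functions on the torus\<close>

definition torus_periodic :: "(real ^ 'm::finite \<Rightarrow> 'b) \<Rightarrow> bool" where
  "torus_periodic f \<longleftrightarrow> (\<forall>x y. torus_rel x y \<longrightarrow> f x = f y)"

lemma torus_rel_shift: "torus_rel x y \<Longrightarrow> torus_rel (x + v) (y + v)"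
  by (simp add: torus_rel_def)

text \<open>Translation by a lattice vector \<open>a - b\<close> fixes \<open>f\<close>, so
  \<open>f\<close> has the same derivatives at \<open>a\<close> and at \<open>b\<close>.\<close>

lemma torus_periodic_frechet_derivative:
  assumes "torus_periodic f"
  shows "torus_periodic (\<lambda>x. frechet_derivative f (at x) v)"
  unfolding torus_periodic_def
proof (intro allI impI)
  fix x y :: "real ^ 'a" assume xy: "torus_rel x y"
  have shift: "(f has_derivative D) (at b)" if "torus_rel a b" "(f has_derivative D) (at a)" for a b D
  proof -
    have "torus_rel (z + (a - b)) z" for z
      using that(1) by (simp add: torus_rel_def)
    then have "(\<lambda>z. f (z + (a - b))) = f"
      using assms unfolding torus_periodic_def by blast
    moreover have "((\<lambda>z. f (z + (a - b))) has_derivative D) (at b)"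
      by (rule has_derivative_compose[where g = f, of _ "\<lambda>h. h"])
        (use that(2) in \<open>auto intro!: derivative_eq_intros\<close>)
    ultimately show ?thesis
      by simp
  qed
  have "torus_rel y x"
    using xy equivp_torus_rel equivp_symp by metis
  \<comment> \<open>Since \<open>frechet_derivative\<close> is a choice, equal values follow once
    the predicates agree for every \<open>D\<close>, also where no derivative exists.\<close>
  then have "(f has_derivative D) (at x) \<longleftrightarrow> (f has_derivative D) (at y)" for D
    using shift xy by blast
  then show "frechet_derivative f (at x) v = frechet_derivative f (at y) v"
    by (simp add: frechet_derivative_def)
qed

lemma torus_rel_representative:
  obtains y :: "real ^ 'm::finite" where "torus_rel x y" "y \<in> cbox 0 (\<chi> i. 2 * pi)"
proof
  define y where "y = (\<chi> i. x $ i - 2 * pi * of_int \<lfloor>x $ i / (2 * pi)\<rfloor>)"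
  show "torus_rel x y"
    by (auto simp: torus_rel_def y_def)
  have "0 \<le> x $ i - 2 * pi * of_int \<lfloor>x $ i / (2 * pi)\<rfloor> \<and>
      x $ i - 2 * pi * of_int \<lfloor>x $ i / (2 * pi)\<rfloor> \<le> 2 * pi" for i
    using floor_divide_lower[of "2 * pi" "x $ i"] floor_divide_upper[of "2 * pi" "x $ i"]
    by (simp add: algebra_simps)
  then show "y \<in> cbox 0 (\<chi> i. 2 * pi)"
    by (simp add: y_def mem_box_cart)
qed

text \<open>Heine-Cantor on a compact box, after moving both points by the same lattice
  vector.\<close>

lemma torus_periodic_uniformly_continuous:
  fixes f :: "real ^ 'm::finite \<Rightarrow> 'b::real_normed_vector"
  assumes "torus_periodic f" "continuous_on UNIV f"
  shows "uniformly_continuous_on UNIV f"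
  unfolding uniformly_continuous_on_def
proof (intro allI impI)
  fix e :: real assume "e > 0"
  \<comment> \<open>The margin 1 around the period cube keeps \<open>y'\<close> in \<open>K\<close>
    when \<open>x'\<close> lies in the cube and the two points are closer than
    \<open>min d 1\<close>.\<close>
  define K :: "(real ^ 'm) set" where "K = cbox (\<chi> i. - 1) (\<chi> i. 2 * pi + 1)"
  have "uniformly_continuous_on K f"
    unfolding K_def by (intro compact_uniformly_continuous continuous_on_subset[OF assms(2)]) auto
  then obtain d where d: "d > 0"
      "\<And>x y. x \<in> K \<Longrightarrow> y \<in> K \<Longrightarrow> dist y x < d \<Longrightarrow> dist (f y) (f x) < e"
    using \<open>e > 0\<close> unfolding uniformly_continuous_on_def by blast
  have "dist (f y) (f x) < e" if "dist y x < min d 1" for x y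
  proof -
    obtain x' where x': "torus_rel x x'" "x' \<in> cbox 0 (\<chi> i. 2 * pi)"
      by (rule torus_rel_representative)
    define y' where "y' = x' + (y - x)"
    have "torus_rel y y'"
      using torus_rel_shift[OF x'(1), of "y - x"] by (simp add: y'_def)
    moreover have "x' \<in> K"
      using x'(2) by (simp add: K_def mem_box_cart) (smt (verit))
    moreover have "y' \<in> K"
    proof -
      have "\<bar>(y - x) $ i\<bar> \<le> 1" for i
        using component_le_norm_cart[of "y - x" i] that by (simp add: dist_norm)
      then show ?thesis
        using x'(2) by (simp add: K_def y'_def mem_box_cart) (smt (verit))
    qed
    moreover have "dist y' x' < d"
      using that by (simp add: y'_def dist_norm)
    ultimately show ?thesis
      using d(2)[of x' y'] assms(1) x'(1) by (simp add: torus_periodic_def)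
  qed
  then show "\<exists>d>0. \<forall>x\<in>UNIV. \<forall>y\<in>UNIV. dist y x < d \<longrightarrow> dist (f y) (f x) < e"
    using d(1) by (intro exI[of _ "min d 1"]) auto
qed

lemma torus_periodic_bounded:
  fixes f :: "real ^ 'm::finite \<Rightarrow> 'b::real_normed_vector"
  assumes "torus_periodic f" "continuous_on UNIV f"
  obtains B where "B > 0" "\<And>x. norm (f x) \<le> B"
proof -
  have "bounded (f ` cbox 0 (\<chi> i. 2 * pi))"
    by (intro compact_imp_bounded compact_continuous_image continuous_on_subset[OF assms(2)]) auto
  then obtain B where "B > 0" "\<And>y. y \<in> cbox 0 (\<chi> i. 2 * pi) \<Longrightarrow> norm (f y) \<le> B"
    unfolding bounded_pos by blast
  then show ?thesis
    using assms(1) torus_rel_representative that unfolding torus_periodic_def by metis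
qed

subsection \<open>The scalar equation\<close>

text \<open>On smooth periodic functions with \<open>Re \<mu> > 0\<close>, minus this transform
  inverts \<open>\<partial>\<^sub>\<omega> - \<mu>\<close>: it is, up to sign, the resolvent of the
  derivative along the flow \<open>x + s *\<^sub>R \<omega>\<close>.\<close>

definition laplace ::
  "complex \<Rightarrow> real ^ 'm::finite \<Rightarrow> (real ^ 'm \<Rightarrow> complex) \<Rightarrow> real ^ 'm \<Rightarrow> complex" where
  "laplace \<mu> \<omega> u x = integral {0..} (\<lambda>s. exp (- \<mu> * of_real s) * u (x + s *\<^sub>R \<omega>))"

definition periodic_continuous :: "(real ^ 'm::finite \<Rightarrow> 'b::topological_space) \<Rightarrow> bool" where
  "periodic_continuous f \<longleftrightarrow> torus_periodic f \<and> continuous_on UNIV f"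

lemma periodic_continuous_shift:
  "periodic_continuous f \<Longrightarrow> periodic_continuous (\<lambda>z. f (z + h))"
  unfolding periodic_continuous_def torus_periodic_def
  by (auto intro!: continuous_on_compose2[of UNIV f] continuous_intros torus_rel_shift)

lemma periodic_continuous_diff:
  fixes f g :: "real ^ 'm::finite \<Rightarrow> 'b::real_normed_vector"
  shows "periodic_continuous f \<Longrightarrow> periodic_continuous g \<Longrightarrow> periodic_continuous (\<lambda>z. f z - g z)"
  unfolding periodic_continuous_def torus_periodic_def
  by (metis continuous_on_diff)

lemma smooth_periodic_continuous:
  "torus_periodic u \<Longrightarrow> smooth u \<Longrightarrow> periodic_continuous u"
  using C_k_imp_continuous_on by (auto simp: periodic_continuous_def smooth_def)

text \<open>The remainder bound is uniform in \<open>x\<close>, so it can be integrated along an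
  unbounded line. Uniform continuity of the directional derivatives makes \<open>Du y - Du x\<close>
  small in operator norm, and the mean value inequality concludes.\<close>

lemma uniform_linearization:
  fixes u :: "real ^ 'm::finite \<Rightarrow> 'b::real_normed_vector"
  assumes "torus_periodic u" "smooth u" "e > 0"
  obtains d where "d > 0"
    "\<And>x h. norm h < d \<Longrightarrow> norm (u (x + h) - u x - frechet_derivative u (at x) h) \<le> e * norm h"
proof -
  define Du where "Du x = frechet_derivative u (at x)" for x
  \<comment> \<open>Each of the \<open>N\<close> basis directions contributes at most
    \<open>e / N\<close> to the operator norm.\<close>
  define N where "N = real (card (Basis :: (real ^ 'm) set))"
  have "N > 0"
    by (simp add: N_def)
  have Du: "(u has_derivative Du x) (at x within S)" for x S
    unfolding Du_def using smooth_has_derivative[OF assms(2)] has_derivative_at_withinI by blast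
  have "\<exists>d>0. \<forall>y z. dist y z < d \<longrightarrow> dist (Du y b) (Du z b) < e / N" for b
  proof -
    have "periodic_continuous (\<lambda>x. Du x b)"
      unfolding Du_def using assms
      by (intro smooth_periodic_continuous torus_periodic_frechet_derivative smooth_frechet_derivative)
    then show ?thesis
      using torus_periodic_uniformly_continuous[of "\<lambda>x. Du x b"] \<open>e > 0\<close> \<open>N > 0\<close>
      unfolding periodic_continuous_def uniformly_continuous_on_def by (metis UNIV_I divide_pos_pos)
  qed
  then obtain D where D: "\<And>b. D b > 0" "\<And>b y z. dist y z < D b \<Longrightarrow> dist (Du y b) (Du z b) < e / N"
    by metis
  define d where "d = Min (D ` (Basis :: (real ^ 'm) set))"
  have "d > 0"
    using D(1) by (auto simp: d_def)
  moreover have "norm (u (x + h) - u x - Du x h) \<le> e * norm h" if h: "norm h < d" for x h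
  proof -
    have B: "onorm (Du y - Du x) \<le> e" if "y \<in> ball x d" for y
    proof -
      have "bounded_linear (Du y - Du x)"
        unfolding fun_diff_def
        using Du has_derivative_bounded_linear by (intro bounded_linear_sub) blast+
      then have "onorm (Du y - Du x) \<le> (\<Sum>b\<in>Basis. norm ((Du y - Du x) b))"
        by (rule onorm_componentwise)
      also have "\<dots> \<le> (\<Sum>b\<in>(Basis :: (real ^ 'm) set). e / N)"
      proof (rule sum_mono)
        fix b :: "real ^ 'm" assume "b \<in> Basis"
        then have "d \<le> D b"
          by (simp add: d_def)
        then show "norm ((Du y - Du x) b) \<le> e / N"
          using D(2)[of y x b] that by (simp add: dist_norm norm_minus_commute)
      qed
      also have "\<dots> = e"
        using \<open>N > 0\<close> by (simp add: N_def)
      finally show ?thesis .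
    qed
    have "x + t *\<^sub>R h \<in> ball x d" if "t \<in> {0..1}" for t
      using that h mult_left_le_one_le[of "norm h" t] by (auto simp: dist_norm)
    then have "norm (u (x + h) - u x - Du x (x + h - x)) \<le> norm (x + h - x) * e"
      using B Du \<open>d > 0\<close> by (intro differentiable_bound_linearization[where S = "ball x d"]) auto
    then show ?thesis
      by (simp add: mult.commute)
  qed
  ultimately show ?thesis
    using that unfolding Du_def by blast
qed

lemma has_vector_derivative_exp_times:
  "((\<lambda>s. exp (\<mu> * of_real s)) has_vector_derivative \<mu> * exp (\<mu> * of_real t)) (at t within S)"
  for \<mu> :: complex
  by (rule has_vector_derivative_real_field[where f = "\<lambda>z. exp (\<mu> * z)"])
    (auto intro!: derivative_eq_intros)

context
  fixes \<mu> :: complex and \<omega> :: "real ^ 'm::finite"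
  assumes Re_pos: "Re \<mu> > 0"
begin

text \<open>The bound \<open>B\<close> on \<open>u\<close> yields the integrable majorant
  \<open>exp (- Re \<mu> * s) * B\<close>. Absolute integrability serves the passage to the limit in
  the integration by parts.\<close>

lemma laplace_integrable:
  assumes "periodic_continuous u"
  shows "(\<lambda>s. exp (- \<mu> * of_real s) * u (x + s *\<^sub>R \<omega>)) absolutely_integrable_on {0..}"
proof -
  obtain B where B: "\<And>x. norm (u x) \<le> B"
    using torus_periodic_bounded assms unfolding periodic_continuous_def by metis
  have "(\<lambda>s. exp (- Re \<mu> * s) * B) integrable_on {0..}"
    using has_integral_exp_minus_to_infinity[OF Re_pos, of 0] has_integral_mult_left by blast
  moreover have "(\<lambda>s. exp (- \<mu> * of_real s) * u (x + s *\<^sub>R \<omega>)) \<in> borel_measurable (lebesgue_on {0..})"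
    using assms unfolding periodic_continuous_def
    by (intro continuous_imp_measurable_on_sets_lebesgue)
      (auto intro!: continuous_intros continuous_on_compose2[of UNIV u])
  ultimately show ?thesis
    by (intro measurable_bounded_by_integrable_imp_absolutely_integrable) (auto simp: norm_mult B)
qed

lemmas laplace_integrable_on = laplace_integrable[THEN absolutely_integrable_on_def[THEN iffD1], THEN conjunct1]

text \<open>The kernel has total mass \<open>1 / Re \<mu>\<close> in absolute value. Continuity and
  differentiability of the transform are deduced from this estimate.\<close>

lemma norm_laplace_le:
  assumes "periodic_continuous u" "\<And>x. norm (u x) \<le> B"
  shows "norm (laplace \<mu> \<omega> u x) \<le> B / Re \<mu>"
proof -
  have I: "((\<lambda>s. exp (- Re \<mu> * s) * B) has_integral 1 / Re \<mu> * B) {0..}"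
    using has_integral_mult_left[OF has_integral_exp_minus_to_infinity[OF Re_pos, of 0]] by simp
  have "norm (laplace \<mu> \<omega> u x) \<le> integral {0..} (\<lambda>s. exp (- Re \<mu> * s) * B)"
    unfolding laplace_def
    by (intro integral_norm_bound_integral laplace_integrable_on assms(1) has_integral_integrable[OF I])
      (auto simp: norm_mult assms(2))
  then show ?thesis
    using integral_unique[OF I] by simp
qed

lemma laplace_diff:
  assumes "periodic_continuous u" "periodic_continuous v"
  shows "laplace \<mu> \<omega> (\<lambda>z. u z - v z) x = laplace \<mu> \<omega> u x - laplace \<mu> \<omega> v x"
  unfolding laplace_def right_diff_distrib
  by (intro integral_diff laplace_integrable_on assms)

lemma laplace_add:
  assumes "periodic_continuous u" "periodic_continuous v"
  shows "laplace \<mu> \<omega> (\<lambda>z. u z + v z) x = laplace \<mu> \<omega> u x + laplace \<mu> \<omega> v x"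
  unfolding laplace_def distrib_left
  by (intro integral_add laplace_integrable_on assms)

lemma laplace_scaleR:
  "laplace \<mu> \<omega> (\<lambda>z. c *\<^sub>R u z) x = c *\<^sub>R laplace \<mu> \<omega> u x"
  unfolding laplace_def by (simp flip: integral_cmul)

text \<open>Commuting with translations makes increments of the transform into transforms of
  increments of \<open>u\<close>.\<close>

lemma laplace_shift: "laplace \<mu> \<omega> u (x + h) = laplace \<mu> \<omega> (\<lambda>z. u (z + h)) x"
  by (simp add: laplace_def algebra_simps)

lemma laplace_periodic: "torus_periodic u \<Longrightarrow> torus_periodic (laplace \<mu> \<omega> u)"
proof (unfold torus_periodic_def, intro allI impI)
  fix x y :: "real ^ 'm"
  assume "\<forall>x y. torus_rel x y \<longrightarrow> u x = u y" "torus_rel x y"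
  then have "u (x + s *\<^sub>R \<omega>) = u (y + s *\<^sub>R \<omega>)" for s
    using torus_rel_shift by blast
  then show "laplace \<mu> \<omega> u x = laplace \<mu> \<omega> u y"
    by (simp add: laplace_def)
qed

lemma laplace_continuous:
  assumes "periodic_continuous u"
  shows "continuous_on UNIV (laplace \<mu> \<omega> u)"
  unfolding continuous_on_iff
proof (intro ballI allI impI)
  fix x :: "real ^ 'm" and e :: real assume "e > 0"
  \<comment> \<open>The factor \<open>Re \<mu>\<close> cancels the division in
    \<open>norm_laplace_le\<close>; the half turns its weak inequality into a strict one.\<close>
  then have "e / 2 * Re \<mu> > 0" using Re_pos by simp
  then obtain d where d: "d > 0" "\<And>y z. dist y z < d \<Longrightarrow> dist (u y) (u z) < e / 2 * Re \<mu>"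
    using torus_periodic_uniformly_continuous[of u] assms
    unfolding uniformly_continuous_on_def periodic_continuous_def by (metis UNIV_I)
  have "dist (laplace \<mu> \<omega> u y) (laplace \<mu> \<omega> u x) < e" if "dist y x < d" for y
  proof -
    have "laplace \<mu> \<omega> u y - laplace \<mu> \<omega> u x = laplace \<mu> \<omega> (\<lambda>z. u (z + (y - x)) - u z) x"
      using laplace_shift[of u x "y - x"]
      by (simp add: laplace_diff periodic_continuous_shift assms)
    also have "norm \<dots> \<le> e / 2 * Re \<mu> / Re \<mu>"
      by (intro norm_laplace_le periodic_continuous_diff periodic_continuous_shift assms less_imp_le)
        (use d(2) that in \<open>simp add: dist_norm\<close>)
    finally show ?thesis
      using \<open>e > 0\<close> Re_pos by (simp add: dist_norm)
  qed
  then show "\<exists>d>0. \<forall>x'\<in>UNIV. dist x' x < d \<longrightarrow> dist (laplace \<mu> \<omega> u x') (laplace \<mu> \<omega> u x) < e"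
    using d(1) by blast
qed

text \<open>Differentiation under the integral: the remainder of the transform is the transform of
  the first-order remainder of \<open>u\<close>, uniformly small by
  \<open>uniform_linearization\<close>.\<close>

lemma laplace_has_derivative:
  assumes "torus_periodic u" "smooth u"
  shows "(laplace \<mu> \<omega> u has_derivative
    (\<lambda>v. laplace \<mu> \<omega> (\<lambda>y. frechet_derivative u (at y) v) x)) (at x)"
proof -
  note [simp] = linear_add[OF has_derivative_linear[OF smooth_has_derivative[OF assms(2)]]]
    linear_cmul[OF has_derivative_linear[OF smooth_has_derivative[OF assms(2)]]]
  have pc: "periodic_continuous u" "periodic_continuous (\<lambda>y. frechet_derivative u (at y) v)" for v
    by (intro smooth_periodic_continuous torus_periodic_frechet_derivative smooth_frechet_derivative assms)+
  have "linear (\<lambda>v. laplace \<mu> \<omega> (\<lambda>y. frechet_derivative u (at y) v) x)"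
    by (rule linearI) (simp_all add: laplace_add laplace_scaleR pc)
  moreover have "\<exists>d>0. \<forall>y. norm (y - x) < d \<longrightarrow> norm (laplace \<mu> \<omega> u y - laplace \<mu> \<omega> u x -
      laplace \<mu> \<omega> (\<lambda>z. frechet_derivative u (at z) (y - x)) x) \<le> e * norm (y - x)" if e: "e > 0" for e
  proof -
    obtain d where d: "d > 0" "\<And>x h. norm h < d \<Longrightarrow>
        norm (u (x + h) - u x - frechet_derivative u (at x) h) \<le> e * Re \<mu> * norm h"
      by (rule uniform_linearization[OF assms mult_pos_pos[OF e Re_pos]]) blast
    have "norm (laplace \<mu> \<omega> u y - laplace \<mu> \<omega> u x -
      laplace \<mu> \<omega> (\<lambda>z. frechet_derivative u (at z) (y - x)) x) \<le> e * norm (y - x)"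
      if "norm (y - x) < d" for y
    proof -
      have "laplace \<mu> \<omega> u y - laplace \<mu> \<omega> u x - laplace \<mu> \<omega> (\<lambda>z. frechet_derivative u (at z) (y - x)) x
          = laplace \<mu> \<omega> (\<lambda>z. u (z + (y - x)) - u z - frechet_derivative u (at z) (y - x)) x"
        using laplace_shift[of u x "y - x"]
        by (simp add: laplace_diff periodic_continuous_diff periodic_continuous_shift pc)
      also have "norm \<dots> \<le> e * Re \<mu> * norm (y - x) / Re \<mu>"
        by (intro norm_laplace_le periodic_continuous_diff periodic_continuous_shift pc d(2) that)
      finally show ?thesis
        using Re_pos by simp
    qed
    then show ?thesis
      using d(1) by blast
  qed
  ultimately show ?thesis
    by (simp add: has_derivative_at_alt linear_conv_bounded_linear)
qed

text \<open>A directional derivative of the transform is the transform of a directional derivative,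
  which is again smooth and periodic, so the induction runs over all such \<open>u\<close>.\<close>

lemma laplace_smooth:
  assumes "torus_periodic u" "smooth u"
  shows "smooth (laplace \<mu> \<omega> u)"
proof -
  have "C_k k (laplace \<mu> \<omega> u)" for k
    using assms
  proof (induction k arbitrary: u)
    case 0
    then show ?case by (simp add: laplace_continuous smooth_periodic_continuous)
  next
    case (Suc k)
    note D = laplace_has_derivative[OF Suc.prems]
    show ?case
      using D Suc.IH[OF torus_periodic_frechet_derivative smooth_frechet_derivative, OF Suc.prems]
      by (auto simp: frechet_derivative_at[OF D, symmetric] differentiable_def)
  qed
  then show ?thesis by (simp add: smooth_def)
qed

text \<open>Integration by parts: \<open>g'\<close> is the derivative of \<open>g\<close>, and its
  integral over the half-line is \<open>- g 0 = - u x\<close>. By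
  \<open>laplace_has_derivative\<close> the left side is the derivative of the transform along
  \<open>\<omega>\<close>.\<close>

lemma laplace_frechet_derivative:
  assumes "torus_periodic u" "smooth u"
  shows "laplace \<mu> \<omega> (\<lambda>y. frechet_derivative u (at y) \<omega>) x = \<mu> * laplace \<mu> \<omega> u x - u x"
proof -
  define g where "g s = exp (- \<mu> * of_real s) * u (x + s *\<^sub>R \<omega>)" for s
  define g' where "g' s = exp (- \<mu> * of_real s) * frechet_derivative u (at (x + s *\<^sub>R \<omega>)) \<omega>
    - \<mu> * (exp (- \<mu> * of_real s) * u (x + s *\<^sub>R \<omega>))" for s
  have pc: "periodic_continuous u" "periodic_continuous (\<lambda>y. frechet_derivative u (at y) v)" for v
    by (intro smooth_periodic_continuous torus_periodic_frechet_derivative smooth_frechet_derivative assms)+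
  have g'_int: "g' absolutely_integrable_on {0..}"
    unfolding g'_def
    by (intro set_integral_diff laplace_integrable pc set_integrable_mult_right)
  have "integral {0..} g' = laplace \<mu> \<omega> (\<lambda>y. frechet_derivative u (at y) \<omega>) x - \<mu> * laplace \<mu> \<omega> u x"
    unfolding g'_def laplace_def
    by (subst integral_diff, intro laplace_integrable_on pc, intro integrable_on_mult_right laplace_integrable_on pc)
      (simp only: integral_mult_right)
  \<comment> \<open>The integral over the half-line is a limit of integrals over
    \<open>{0..b}\<close>, obtained by passing to Lebesgue integrals.\<close>
  moreover have "((\<lambda>b. integral {0..b} g') \<longlongrightarrow> integral {0..} g') at_top"
  proof -
    have "g' absolutely_integrable_on {0..b}" for b
      by (rule set_integrable_subset[OF g'_int]) auto
    then show ?thesis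
      using tendsto_set_lebesgue_integral_at_top[OF _ g'_int] g'_int
      by (simp add: set_lebesgue_integral_eq_integral)
  qed
  moreover have "((\<lambda>b. integral {0..b} g') \<longlongrightarrow> - u x) at_top"
  proof -
    have "(g has_vector_derivative g' s) (at s within S)" for s S
      using has_vector_derivative_mult[OF has_vector_derivative_exp_times[of "- \<mu>"]
          has_vector_derivative_along_line[OF assms(2)]]
      unfolding g_def g'_def by (simp add: algebra_simps)
    then have FTC: "(g' has_integral g b - g 0) {0..b}" if "b \<ge> 0" for b
      using that by (intro fundamental_theorem_of_calculus) auto
    have "\<forall>\<^sub>F b in at_top. g b - g 0 = integral {0..b} g'"
      using eventually_ge_at_top[of 0] by eventually_elim (simp add: integral_unique[OF FTC])
    \<comment> \<open>The boundary term at infinity vanishes because \<open>u\<close> is bounded and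
      the kernel decays.\<close>
    moreover have "((\<lambda>b. g b - g 0) \<longlongrightarrow> 0 - g 0) at_top"
    proof (intro tendsto_intros)
      obtain B where B: "\<And>x. norm (u x) \<le> B"
        using torus_periodic_bounded pc(1) unfolding periodic_continuous_def by metis
      have "((\<lambda>b. exp (- Re \<mu> * b) * B) \<longlongrightarrow> 0) at_top"
        using Re_pos
        by (intro tendsto_mult_left_zero filterlim_compose[OF exp_at_bot]
            filterlim_tendsto_neg_mult_at_bot[OF tendsto_const _ filterlim_ident]) auto
      then show "(g \<longlongrightarrow> 0) at_top"
        by (rule Lim_null_comparison[rotated]) (auto simp: g_def norm_mult B)
    qed
    ultimately show ?thesis
      by (simp add: g_def tendsto_cong)
  qed
  ultimately have "laplace \<mu> \<omega> (\<lambda>y. frechet_derivative u (at y) \<omega>) x - \<mu> * laplace \<mu> \<omega> u x = - u x"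
    using tendsto_unique[OF trivial_limit_at_top_linorder] by metis
  then show ?thesis
    by (simp add: algebra_simps)
qed

end

lemma scalar_equation_solvable:
  fixes \<omega> :: "real ^ 'm::finite"
  assumes "Re \<mu> \<noteq> 0" "torus_periodic u" "smooth u"
  shows "\<exists>a. torus_periodic a \<and> smooth a \<and> (\<forall>x. frechet_derivative a (at x) \<omega> - \<mu> * a x = u x)"
proof -
  \<comment> \<open>Stated for all exponents and directions, so that it also applies to
    \<open>- \<mu>\<close> and \<open>- \<omega>\<close> when \<open>Re \<mu> < 0\<close>.\<close>
  have *: "\<exists>a. torus_periodic a \<and> smooth a \<and> (\<forall>x. frechet_derivative a (at x) \<omega> - \<mu> * a x = - u x)"
    if "Re \<mu> > 0" for \<mu> and \<omega> :: "real ^ 'm"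
    using laplace_periodic laplace_smooth laplace_frechet_derivative[OF that assms(2,3), of \<omega>]
      laplace_has_derivative[OF that assms(2,3), THEN frechet_derivative_at, symmetric] assms that
    by (intro exI[of _ "laplace \<mu> \<omega> u"]) auto
  show ?thesis
  proof (cases "Re \<mu> > 0")
    case True
    then obtain a where a: "torus_periodic a" "smooth a"
        "\<And>x. frechet_derivative a (at x) \<omega> - \<mu> * a x = - u x"
      using * by blast
    have "((\<lambda>x. - a x) has_derivative (\<lambda>v. - frechet_derivative a (at x) v)) (at x)" for x
      by (intro has_derivative_minus smooth_has_derivative a)
    then have "frechet_derivative (\<lambda>x. - a x) (at x) \<omega> = - frechet_derivative a (at x) \<omega>" for x
      by (metis frechet_derivative_at)
    then show ?thesis
      using a smooth_bounded_linear[OF bounded_linear_minus[OF bounded_linear_ident] a(2)]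
      by (intro exI[of _ "\<lambda>x. - a x"]) (auto simp: torus_periodic_def minus_equation_iff algebra_simps)
  next
    case False
    then obtain a where a: "torus_periodic a" "smooth a"
        "\<And>x. frechet_derivative a (at x) (- \<omega>) - (- \<mu>) * a x = - u x"
      using *[of "- \<mu>" "- \<omega>"] assms(1) by auto
    have "frechet_derivative a (at x) (- \<omega>) = - frechet_derivative a (at x) \<omega>" for x
      using has_derivative_linear[OF smooth_has_derivative[OF a(2)]] linear_neg by blast
    \<comment> \<open>Reversing direction and exponent negates the operator, which matches the sign
      of \<open>- u\<close>; here \<open>a\<close> itself is the solution, whereas for
      \<open>Re \<mu> > 0\<close> it is \<open>- a\<close>.\<close>
    then have "- (frechet_derivative a (at x) \<omega> - \<mu> * a x) = - u x" for x
      using a(3)[of x] by simp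
    then have "frechet_derivative a (at x) \<omega> - \<mu> * a x = u x" for x
      using neg_equal_iff_equal by blast
    then show ?thesis using a by blast
  qed
qed

subsection \<open>The minimal polynomial of a complex matrix\<close>

text \<open>The vector \<open>p(A) v\<close>, with powers of \<open>A\<close> taken as iterates
  acting on \<open>v\<close>.\<close>

definition poly_apply :: "complex ^ 'n ^ 'n \<Rightarrow> complex poly \<Rightarrow> complex ^ 'n::finite \<Rightarrow> complex ^ 'n" where
  "poly_apply A p v = (\<Sum>i\<le>degree p. coeff p i *s ((*v) A ^^ i) v)"

text \<open>Padding with zero coefficients puts polynomials of different degrees on a common index
  range.\<close>

lemma poly_apply_altdef:
  "degree p \<le> N \<Longrightarrow> poly_apply A p v = (\<Sum>i\<le>N. coeff p i *s ((*v) A ^^ i) v)"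
  unfolding poly_apply_def by (rule sum.mono_neutral_left) (auto simp: coeff_eq_0 not_le)

lemma poly_apply_0 [simp]: "poly_apply A 0 v = 0"
  by (simp add: poly_apply_def)

text \<open>Horner's rule, which opens the way to induction on \<open>p\<close>.\<close>

lemma poly_apply_pCons:
  "poly_apply A (pCons a p) v = a *s v + A *v poly_apply A p v"
proof -
  have "poly_apply A (pCons a p) v = (\<Sum>i\<le>Suc (degree p). coeff (pCons a p) i *s ((*v) A ^^ i) v)"
    by (rule poly_apply_altdef) (simp add: degree_pCons_le)
  also have "\<dots> = a *s v + (\<Sum>i\<le>degree p. A *v (coeff p i *s ((*v) A ^^ i) v))"
    by (subst sum.atMost_Suc_shift) (simp add: vector_scalar_commute)
  also have "\<dots> = a *s v + A *v poly_apply A p v"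
    by (simp add: poly_apply_def vec.linear_sum[OF matrix_vector_mul_linear_gen])
  finally show ?thesis .
qed

lemma poly_apply_add_right:
  "poly_apply A p (v + w) = poly_apply A p v + poly_apply A p w"
  by (induction p) (simp_all add: poly_apply_pCons vec.scale_right_distrib matrix_vector_right_distrib algebra_simps)

lemma poly_apply_scale_right: "poly_apply A p (c *s v) = c *s poly_apply A p v"
  by (induction p) (simp_all add: poly_apply_pCons vec.scale_right_distrib vector_scalar_commute mult.commute)

lemma poly_apply_diff_right:
  "poly_apply A p (v - w) = poly_apply A p v - poly_apply A p w"
  using poly_apply_add_right[of A p "v - w" w] by simp

lemma poly_apply_matrix_right: "poly_apply A p (A *v v) = A *v poly_apply A p v"
  by (induction p) (simp_all add: poly_apply_pCons matrix_vector_right_distrib vector_scalar_commute)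

lemma poly_apply_add: "poly_apply A (p + q) v = poly_apply A p v + poly_apply A q v"
proof -
  let ?N = "max (degree p) (degree q)"
  show ?thesis
    by (simp add: poly_apply_altdef[of _ ?N] degree_add_le vec.scale_left_distrib sum.distrib)
qed

lemma poly_apply_smult: "poly_apply A (smult c p) v = c *s poly_apply A p v"
  by (simp add: poly_apply_altdef[of _ "degree p"] degree_smult_le vec.scale_sum_right)

lemma poly_apply_linear_factor:
  "poly_apply A ([:- \<mu>, 1:] * q) v = A *v poly_apply A q v - \<mu> *s poly_apply A q v"
proof -
  have "[:- \<mu>, 1:] * q = smult (- \<mu>) q + pCons 0 q"
    by simp
  then show ?thesis
    by (simp only: poly_apply_add poly_apply_smult poly_apply_pCons) simp
qed

text \<open>Since \<open>A\<close> commutes with \<open>q(A)\<close>, the linear factor may act on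
  the vector first. If the product annihilates \<open>v\<close>, then \<open>q\<close> annihilates
  \<open>(A - \<mu>) v\<close>: the step in both inductions over factors.\<close>

lemma poly_apply_linear_factor':
  "poly_apply A ([:- \<mu>, 1:] * q) v = poly_apply A q (A *v v - \<mu> *s v)"
  by (simp only: poly_apply_linear_factor poly_apply_diff_right poly_apply_matrix_right poly_apply_scale_right)

text \<open>For an indexed family a repeated vector is itself a relation, with coefficients 1 and
  -1; otherwise \<open>N + 1\<close> distinct vectors exceed the dimension and are
  dependent.\<close>

lemma ex_linear_relation:
  fixes f :: "nat \<Rightarrow> 'a::euclidean_space"
  assumes "N \<ge> DIM('a)"
  shows "\<exists>c. (\<exists>i\<le>N. c i \<noteq> 0) \<and> (\<Sum>i\<le>N. c i *\<^sub>R f i) = 0"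
proof (cases "inj_on f {..N}")
  case True
  then have "card (f ` {..N}) > DIM('a)"
    using assms by (simp add: card_image)
  then have "dependent (f ` {..N})"
    using dependent_biggerset by blast
  then obtain u where u: "\<exists>v\<in>f ` {..N}. u v \<noteq> 0" "(\<Sum>v\<in>f ` {..N}. u v *\<^sub>R v) = 0"
    using real_vector.dependent_finite[of "f ` {..N}"] by auto
  then show ?thesis
    using sum.reindex[OF True, of "\<lambda>v. u v *\<^sub>R v"] by (intro exI[of _ "\<lambda>i. u (f i)"]) auto
next
  case False
  then obtain i j where ij: "i \<le> N" "j \<le> N" "i \<noteq> j" "f i = f j"
    by (auto simp: inj_on_def)
  have "(\<Sum>k\<le>N. (if k = i then 1 else if k = j then - 1 else 0) *\<^sub>R f k)
      = (\<Sum>k\<in>{i, j}. (if k = i then 1 else if k = j then - 1 else 0) *\<^sub>R f k)"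
    by (rule sum.mono_neutral_right) (use ij in auto)
  also have "\<dots> = 0"
    using ij by simp
  finally show ?thesis
    using ij(1) by (intro exI[of _ "\<lambda>k. if k = i then 1 else if k = j then - 1 else 0"]) auto
qed

text \<open>The powers of \<open>A\<close> lie in a finite-dimensional real space of matrices; the
  coefficients of a linear relation among them form the polynomial.\<close>

lemma ex_annihilating_poly:
  fixes A :: "complex ^ 'n::finite ^ 'n"
  shows "\<exists>p. p \<noteq> 0 \<and> (\<forall>v. poly_apply A p v = 0)"
proof -
  \<comment> \<open>\<open>P i\<close> is the matrix power A^i, built by repeated left
    multiplication.\<close>
  define P where "P i = (((**) A) ^^ i) (mat 1)" for i
  have P: "P i *v v = ((*v) A ^^ i) v" for i v
    by (induction i) (simp_all add: P_def flip: matrix_vector_mul_assoc)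
  obtain N where "N \<ge> DIM(complex ^ 'n ^ 'n)" by blast
  then obtain c :: "nat \<Rightarrow> real" where c: "\<exists>i\<le>N. c i \<noteq> 0" "(\<Sum>i\<le>N. c i *\<^sub>R P i) = 0"
    using ex_linear_relation[of N P] by blast
  define p where "p = (\<Sum>i\<le>N. monom (complex_of_real (c i)) i)"
  have coeff_p: "coeff p i = complex_of_real (c i)" if "i \<le> N" for i
    using that by (simp add: p_def coeff_sum_monom)
  have "degree p \<le> N"
    unfolding p_def by (intro degree_sum_le) (auto intro: order_trans[OF degree_monom_le])
  have "poly_apply A p v = 0" for v
  proof -
    have "poly_apply A p v = (\<Sum>i\<le>N. complex_of_real (c i) *s (P i *v v))"
      using \<open>degree p \<le> N\<close> by (simp add: poly_apply_altdef[of p N] coeff_p P)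
    also have "\<dots> = (\<Sum>i\<le>N. c i *\<^sub>R P i) *v v"
      by (simp add: vec_eq_iff matrix_vector_mult_def sum_distrib_left sum_distrib_right
          scaleR_conv_of_real[where 'a = complex] mult.assoc sum.swap[of _ UNIV "{..N}"])
    finally show ?thesis
      by (simp add: c(2))
  qed
  moreover have "p \<noteq> 0"
    using c(1) coeff_p by (metis coeff_0 of_real_eq_0_iff)
  ultimately show ?thesis by blast
qed

text \<open>Take \<open>p\<close> of least degree. If \<open>p = (X - \<mu>) q\<close>, then
  \<open>q\<close> is too short to annihilate everything, and any nonzero \<open>q(A) v\<close> is
  an eigenvector for \<open>\<mu>\<close>.\<close>

lemma ex_annihilating_poly_roots_eigenvalues:
  fixes A :: "complex ^ 'n::finite ^ 'n"
  obtains p where "p \<noteq> 0" "\<And>v. poly_apply A p v = 0"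
    "\<And>\<mu>. poly p \<mu> = 0 \<Longrightarrow> \<exists>v. v \<noteq> 0 \<and> A *v v = \<mu> *s v"
proof -
  define Q where "Q p \<longleftrightarrow> p \<noteq> 0 \<and> (\<forall>v. poly_apply A p v = 0)" for p
  obtain p0 where "Q p0"
    using ex_annihilating_poly[of A] unfolding Q_def by blast
  then obtain p where p: "Q p" "\<And>q. Q q \<Longrightarrow> degree p \<le> degree q"
    using ex_has_least_nat[of Q p0 degree] by blast
  have "\<exists>v. v \<noteq> 0 \<and> A *v v = \<mu> *s v" if root: "poly p \<mu> = 0" for \<mu>
  proof -
    obtain q where q: "p = [:- \<mu>, 1:] * q"
      using poly_eq_0_iff_dvd[THEN iffD1, OF root] by (rule dvdE)
    then have "q \<noteq> 0"
      using p(1) by (auto simp: Q_def)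
    then have "degree p = Suc (degree q)"
      unfolding q by (subst degree_mult_eq) auto
    then obtain v where "poly_apply A q v \<noteq> 0"
      using p(2)[of q] \<open>q \<noteq> 0\<close> by (auto simp: Q_def)
    moreover have "A *v poly_apply A q v = \<mu> *s poly_apply A q v"
      using p(1) poly_apply_linear_factor[of A \<mu> q v] unfolding q[symmetric] Q_def by simp
    ultimately show ?thesis by blast
  qed
  then show ?thesis
    using p(1) that by (auto simp: Q_def)
qed

lemma complex_poly_root_induct [consumes 1, case_names const factor]:
  fixes p :: "complex poly"
  assumes "p \<noteq> 0" "\<And>c. c \<noteq> 0 \<Longrightarrow> P [:c:]"
    "\<And>\<mu> q. q \<noteq> 0 \<Longrightarrow> P q \<Longrightarrow> P ([:- \<mu>, 1:] * q)"
  shows "P p"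
  using assms(1)
proof (induction "degree p" arbitrary: p)
  case 0
  then show ?case
    using assms(2) by (metis degree_eq_zeroE pCons_0_0)
next
  case (Suc n)
  then have "\<not> constant (poly p)"
    by (simp add: constant_degree)
  then obtain \<mu> q where q: "p = [:- \<mu>, 1:] * q"
    using fundamental_theorem_of_algebra[of p] by (auto simp: poly_eq_0_iff_dvd)
  then have "q \<noteq> 0"
    using Suc.prems by auto
  then have "degree p = Suc (degree q)"
    unfolding q by (subst degree_mult_eq) auto
  then show ?case
    using Suc.hyps \<open>q \<noteq> 0\<close> assms(3) unfolding q by auto
qed

subsection \<open>Solving the normal equation factor by factor\<close>

lemma frechet_derivative_add:
  assumes "smooth f" "smooth g"
  shows "frechet_derivative (\<lambda>x. f x + g x) (at x) v
    = frechet_derivative f (at x) v + frechet_derivative g (at x) v"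
  using frechet_derivative_at[OF has_derivative_add[OF assms[THEN smooth_has_derivative]]] by metis

lemma frechet_derivative_diff:
  assumes "smooth f" "smooth g"
  shows "frechet_derivative (\<lambda>x. f x - g x) (at x) v
    = frechet_derivative f (at x) v - frechet_derivative g (at x) v"
  using frechet_derivative_at[OF has_derivative_diff[OF assms[THEN smooth_has_derivative]]] by metis

lemma frechet_derivative_bounded_linear:
  assumes "bounded_linear T" "smooth f"
  shows "frechet_derivative (\<lambda>x. T (f x)) (at x) v = T (frechet_derivative f (at x) v)"
  using frechet_derivative_at[OF bounded_linear.has_derivative[OF assms(1) smooth_has_derivative[OF assms(2)]]]
  by metis

lemma bounded_linear_vector_scale: "bounded_linear (\<lambda>z. z *s w)" for w :: "complex ^ 'n::finite"
  unfolding linear_conv_bounded_linear[symmetric]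
  by (rule linearI) (simp_all add: vec.scale_left_distrib vec_eq_iff)

definition solves ::
  "complex ^ 'n::finite ^ 'n \<Rightarrow> real ^ 'm::finite \<Rightarrow> (real ^ 'm \<Rightarrow> complex ^ 'n) \<Rightarrow>
    (real ^ 'm \<Rightarrow> complex ^ 'n) \<Rightarrow> bool" where
  "solves A \<omega> V h \<longleftrightarrow> torus_periodic h \<and> smooth h \<and>
    (\<forall>x. frechet_derivative h (at x) \<omega> - A *v h x = V x)"

lemma solves_zero: "solves A \<omega> (\<lambda>x. 0) (\<lambda>x. 0)"
  by (simp add: solves_def torus_periodic_def smooth_const)

lemma solves_add:
  assumes "solves A \<omega> V h" "solves A \<omega> W k"
  shows "solves A \<omega> (\<lambda>x. V x + W x) (\<lambda>x. h x + k x)"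
  using assms unfolding solves_def torus_periodic_def
  by (auto simp: smooth_add frechet_derivative_add algebra_simps)

text \<open>With \<open>a\<close> solving the scalar equation for \<open>\<mu>\<close> and
  \<open>u\<close>, the trial solution \<open>a w\<close> leaves the error
  \<open>a (A - \<mu>) w\<close>. This has the same rank-one form, with a vector annihilated by
  \<open>q\<close>, so the induction varies both \<open>u\<close> and \<open>w\<close>. A nonzero
  constant annihilates only \<open>w = 0\<close>.\<close>

lemma rank_one_solvable:
  assumes "p \<noteq> 0" "\<And>\<mu>. poly p \<mu> = 0 \<Longrightarrow> Re \<mu> \<noteq> 0" "poly_apply A p w = 0"
    "torus_periodic u" "smooth u"
  shows "\<exists>h. solves A \<omega> (\<lambda>x. u x *s w) h"
  using assms
proof (induction p arbitrary: u w rule: complex_poly_root_induct)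
  case (const c)
  then have "w = 0"
    by (simp add: poly_apply_pCons)
  then show ?case
    using solves_zero by auto
next
  case (factor \<mu> q)
  obtain a where a: "torus_periodic a" "smooth a"
      "\<And>x. frechet_derivative a (at x) \<omega> - \<mu> * a x = u x"
    using scalar_equation_solvable[of \<mu> u \<omega>] factor.prems by auto
  have Da: "frechet_derivative a (at x) \<omega> = u x + \<mu> * a x" for x
    using a(3)[of x] by (simp add: algebra_simps)
  obtain h where h: "solves A \<omega> (\<lambda>x. a x *s (A *v w - \<mu> *s w)) h"
    using factor.IH[of "A *v w - \<mu> *s w" a] factor.prems a(1,2)
    unfolding poly_apply_linear_factor' by auto
  have "solves A \<omega> (\<lambda>x. u x *s w - a x *s (A *v w - \<mu> *s w)) (\<lambda>x. a x *s w)"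
    using a(1) smooth_bounded_linear[OF bounded_linear_vector_scale a(2)]
    by (auto simp: solves_def torus_periodic_def Da vector_scalar_commute algebra_simps
        frechet_derivative_bounded_linear[OF bounded_linear_vector_scale a(2)]
        vec.scale_left_distrib vec.scale_right_diff_distrib)
  from solves_add[OF this h] show ?case
    by auto
qed

lemma sum_solvable:
  assumes "finite I" "\<And>i. i \<in> I \<Longrightarrow> \<exists>h. solves A \<omega> (V i) h"
  shows "\<exists>h. solves A \<omega> (\<lambda>x. \<Sum>i\<in>I. V i x) h"
  using assms
proof (induction I rule: finite_induct)
  case empty
  then show ?case using solves_zero by auto
next
  case (insert i I)
  then obtain h k where "solves A \<omega> (V i) h" "solves A \<omega> (\<lambda>x. \<Sum>i\<in>I. V i x) k"
    by blast
  from solves_add[OF this] insert.hyps show ?case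
    by auto
qed

section \<open>Bounded solutions on the line vanish\<close>

lemma bounded_exponential_eq_zero:
  fixes f :: "real \<Rightarrow> complex"
  assumes "\<And>t. (f has_vector_derivative \<mu> * f t) (at t)" "\<And>t. norm (f t) \<le> B" "Re \<mu> \<noteq> 0"
  shows "f t = 0"
proof -
  have "((\<lambda>s. exp (- \<mu> * of_real s) * f s) has_vector_derivative 0) (at s within UNIV)" for s
    using has_vector_derivative_mult[OF has_vector_derivative_exp_times[of "- \<mu>"] assms(1)[of s]]
    by simp
  then obtain c where "\<And>s. exp (- \<mu> * of_real s) * f s = c"
    using has_vector_derivative_zero_constant[of UNIV "\<lambda>s. exp (- \<mu> * of_real s) * f s"] by auto
  then have f: "f s = c * exp (\<mu> * of_real s)" for s
    by (metis exp_minus_inverse mult.assoc mult.commute mult_1 mult_minus_left)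
  have "c = 0"
  proof (rule ccontr)
    assume "c \<noteq> 0"
    \<comment> \<open>The time is chosen, with the sign of \<open>Re \<mu>\<close> taken into
      account, so that the exponent has real part \<open>B / norm c\<close>; then the norm is at
      least \<open>norm c + B\<close>.\<close>
    have "norm c * exp (B / norm c) \<le> B"
      using assms(2)[of "B / norm c / Re \<mu>"] assms(3) by (simp add: f norm_mult)
    moreover have "norm c * (1 + B / norm c) \<le> norm c * exp (B / norm c)"
      by (intro mult_left_mono exp_ge_add_one_self) auto
    ultimately show False
      using \<open>c \<noteq> 0\<close> zero_less_norm_iff[of c] by (simp add: distrib_left del: zero_less_norm_iff)
  qed
  then show ?thesis
    by (simp add: f)
qed

text \<open>\<open>(A - \<mu>) x\<close> is again a bounded solution and is annihilated by the
  shorter factor \<open>q\<close>, so it vanishes by induction.\<close>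

lemma bounded_solution_eq_zero:
  fixes x :: "real \<Rightarrow> complex ^ 'n::finite"
  assumes "p \<noteq> 0" "\<And>\<mu>. poly p \<mu> = 0 \<Longrightarrow> Re \<mu> \<noteq> 0" "\<And>t. poly_apply A p (x t) = 0"
    "\<And>t. (x has_vector_derivative A *v x t) (at t)" "bounded (range x)"
  shows "x t = 0"
  using assms
proof (induction p arbitrary: x t rule: complex_poly_root_induct)
  case (const c)
  then show ?case
    by (simp add: poly_apply_pCons)
next
  case (factor \<mu> q)
  define T where "T v = A *v v - \<mu> *s v" for v
  have T: "bounded_linear T"
    unfolding linear_conv_bounded_linear[symmetric] T_def
  proof (rule linearI)
    fix r :: real and v :: "complex ^ 'n"
    have scaleR: "r *\<^sub>R v = complex_of_real r *s v" for v :: "complex ^ 'n"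
      by (simp add: vec_eq_iff scaleR_conv_of_real[where 'a = complex])
    show "A *v (r *\<^sub>R v) - \<mu> *s (r *\<^sub>R v) = r *\<^sub>R (A *v v - \<mu> *s v)"
      by (simp add: scaleR vector_scalar_commute vec.scale_right_diff_distrib mult.commute)
  qed (simp add: matrix_vector_right_distrib vec.scale_right_distrib)
  have "T (x t) = 0" for t
  proof (rule factor.IH)
    show "poly_apply A q (T (x t)) = 0" for t
      using factor.prems(2)[of t] unfolding poly_apply_linear_factor' T_def .
    show "((\<lambda>t. T (x t)) has_vector_derivative A *v T (x t)) (at t)" for t
      using bounded_linear.has_vector_derivative[OF T factor.prems(3)[of t]]
      by (simp add: T_def matrix_vector_mult_diff_distrib vector_scalar_commute)
    show "bounded (range (\<lambda>t. T (x t)))"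
      using bounded_linear_image[OF factor.prems(4) T] by (simp add: image_image)
  qed (use factor.prems(1) in auto)
  then have "A *v x t = \<mu> *s x t" for t
    by (simp add: T_def)
  \<comment> \<open>Along this solution \<open>A\<close> acts as the scalar \<open>\<mu>\<close>, so
    the system decouples into scalar exponentials.\<close>
  then have "((\<lambda>t. x t $ i) has_vector_derivative \<mu> * x t $ i) (at t)" for i t
    using bounded_linear.has_vector_derivative[OF bounded_linear_vec_nth factor.prems(3)[of t], of i]
    by simp
  moreover obtain B where B: "\<And>t. norm (x t) \<le> B"
    using factor.prems(4) unfolding bounded_iff by auto
  have "norm (x t $ i) \<le> B" for i t
    by (rule order_trans[OF Finite_Cartesian_Product.norm_nth_le B])
  moreover have "Re \<mu> \<noteq> 0"
    using factor.prems(1) by simp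
  ultimately have "x t $ i = 0" for i
    by (rule bounded_exponential_eq_zero)
  then show ?case
    by (simp add: vec_eq_iff)
qed

section \<open>Passage between the torus and lifts\<close>

lemma torus_cases:
  obtains x where "\<phi> = abs_torus x"
  using Quotient3_abs_rep[OF Quotient3_torus] by metis

lemma torus_periodic_abs_torus: "torus_periodic (\<lambda>x. f (abs_torus x))"
  by (simp add: torus_periodic_def flip: torus.abs_eq_iff)

lemma torus_periodic_factor:
  assumes "torus_periodic F"
  obtains f where "\<And>x. f (abs_torus x) = F x"
proof
  show "(F \<circ> rep_torus) (abs_torus x) = F x" for x
    using assms Quotient3_abs_rep[OF Quotient3_torus]
    unfolding torus_periodic_def by (metis torus.abs_eq_iff comp_apply)
qed

text \<open>\<open>torus_shift\<close> lifts to addition, and smoothness of the lift ensures that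
  the derivative selected in \<open>dir_deriv\<close> exists.\<close>

lemma dir_deriv_abs_torus:
  assumes "torus_smooth f"
  shows "dir_deriv \<omega> f (abs_torus x) = frechet_derivative (\<lambda>y. f (abs_torus y)) (at x) \<omega>"
  using has_vector_derivative_along_line[of "\<lambda>y. f (abs_torus y)" x \<omega> 0 UNIV] assms
  by (simp add: dir_deriv_def torus_smooth_def torus_shift.abs_eq vector_derivative_at)

lemma torus_smooth_dir_deriv: "torus_smooth f \<Longrightarrow> torus_smooth (dir_deriv \<omega> f)"
  by (subst torus_smooth_def) (simp add: dir_deriv_abs_torus smooth_frechet_derivative torus_smooth_def)

section \<open>Complexification and the normal equation\<close>

definition complexify :: "real ^ 'n::finite \<Rightarrow> complex ^ 'n" where
  "complexify v = (\<chi> i. of_real (v $ i))"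

definition Re_vec :: "complex ^ 'n::finite \<Rightarrow> real ^ 'n" where
  "Re_vec z = (\<chi> i. Re (z $ i))"

definition complex_matrix :: "(real ^ 'n \<Rightarrow> real ^ 'n) \<Rightarrow> complex ^ 'n::finite ^ 'n" where
  "complex_matrix L = (\<chi> i j. complex_of_real (matrix L $ i $ j))"

lemma Re_vec_complexify [simp]: "Re_vec (complexify v) = v"
  by (simp add: Re_vec_def complexify_def vec_eq_iff)

lemma Re_vec_add: "Re_vec (v + w) = Re_vec v + Re_vec w"
  by (simp add: Re_vec_def vec_eq_iff)

lemma bounded_linear_complexify: "bounded_linear complexify"
  unfolding linear_conv_bounded_linear[symmetric] complexify_def
  by (rule linearI) (simp_all add: vec_eq_iff scaleR_conv_of_real[where 'a = complex])

lemma bounded_linear_Re_vec: "bounded_linear Re_vec"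
  unfolding linear_conv_bounded_linear[symmetric] Re_vec_def
  by (rule linearI) (simp_all add: vec_eq_iff)

lemma complex_matrix_complexify:
  assumes "linear L"
  shows "complex_matrix L *v complexify v = complexify (L v)"
proof -
  have "complex_matrix L *v complexify v = complexify (matrix L *v v)"
    by (simp add: vec_eq_iff complexify_def complex_matrix_def matrix_vector_mult_def)
  then show ?thesis
    using fun_cong[OF matrix_vector_mul(2)[OF assms], of v] by simp
qed

text \<open>The matrix entries are real, so real parts of complex solutions solve the real
  equation.\<close>

lemma Re_vec_complex_matrix:
  assumes "linear L"
  shows "Re_vec (complex_matrix L *v z) = L (Re_vec z)"
proof -
  have "Re_vec (complex_matrix L *v z) = matrix L *v Re_vec z"
    by (simp add: vec_eq_iff Re_vec_def complex_matrix_def matrix_vector_mult_def)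
  then show ?thesis
    using fun_cong[OF matrix_vector_mul(2)[OF assms], of "Re_vec z"] by simp
qed

text \<open>Expanding the complexified \<open>V\<close> in the standard basis gives rank-one
  right-hand sides. The sum of their solutions is projected to its real part and descends to the
  torus by periodicity.\<close>

lemma normal_equation_solvable:
  fixes L :: "real ^ 'n::finite \<Rightarrow> real ^ 'n" and V :: "'m::finite torus \<Rightarrow> real ^ 'n"
  assumes "linear L" "\<And>\<mu>. is_eigenvalue L \<mu> \<Longrightarrow> Re \<mu> \<noteq> 0" "torus_smooth V"
  shows "\<exists>h. torus_smooth h \<and> (\<forall>\<phi>. dir_deriv \<omega> h \<phi> - L (h \<phi>) = V \<phi>)"
proof -
  define A where "A = complex_matrix L"
  obtain p where p: "p \<noteq> 0" "\<And>v. poly_apply A p v = 0"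
      "\<And>\<mu>. poly p \<mu> = 0 \<Longrightarrow> \<exists>v. v \<noteq> 0 \<and> A *v v = \<mu> *s v"
    using ex_annihilating_poly_roots_eigenvalues by blast
  \<comment> \<open>Every root of \<open>p\<close> is an eigenvalue of the complexified
    \<open>L\<close>, so the spectral hypothesis applies.\<close>
  have roots: "Re \<mu> \<noteq> 0" if "poly p \<mu> = 0" for \<mu>
    using p(3)[OF that] assms(2) unfolding is_eigenvalue_def A_def complex_matrix_def by blast
  define u where "u i x = complexify (V (abs_torus x)) $ i" for i x
  have "\<exists>h. solves A \<omega> (\<lambda>x. u i x *s axis i 1) h" for i
  proof (rule rank_one_solvable[OF p(1) roots p(2)])
    show "torus_periodic (u i)"
      unfolding u_def by (rule torus_periodic_abs_torus)
    show "smooth (u i)"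
      using assms(3) unfolding u_def torus_smooth_def
      by (intro smooth_bounded_linear[OF bounded_linear_vec_nth] 
          smooth_bounded_linear[OF bounded_linear_complexify])
  qed
  then obtain h where "solves A \<omega> (\<lambda>x. \<Sum>i\<in>UNIV. u i x *s axis i 1) h"
    using sum_solvable[of UNIV A \<omega> "\<lambda>i x. u i x *s axis i 1"] by auto
  moreover have "(\<Sum>i\<in>UNIV. u i x *s axis i 1) = complexify (V (abs_torus x))" for x
    unfolding u_def by (rule basis_expansion)
  ultimately have h: "torus_periodic h" "smooth h"
      "frechet_derivative h (at x) \<omega> = complexify (V (abs_torus x)) + A *v h x" for x
    by (auto simp: solves_def diff_eq_eq)
  have "torus_periodic (\<lambda>x. Re_vec (h x))"
    using h(1) by (simp add: torus_periodic_def)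
  then obtain k where k: "\<And>x. k (abs_torus x) = Re_vec (h x)"
    by (rule torus_periodic_factor) blast
  have "torus_smooth k"
    using smooth_bounded_linear[OF bounded_linear_Re_vec h(2)] by (simp add: torus_smooth_def k)
  moreover have "dir_deriv \<omega> k (abs_torus x) - L (k (abs_torus x)) = V (abs_torus x)" for x
    by (simp add: Re_vec_complex_matrix[OF assms(1)] Re_vec_add
        dir_deriv_abs_torus[OF \<open>torus_smooth k\<close>] k h(3) A_def
        frechet_derivative_bounded_linear[OF bounded_linear_Re_vec h(2)])
  then have "dir_deriv \<omega> k \<phi> - L (k \<phi>) = V \<phi>" for \<phi>
    by (metis torus_cases)
  ultimately show ?thesis by blast
qed

text \<open>Restricted to a line in the direction \<open>\<omega>\<close>, the complexified
  difference is a solution of \<open>y' = A y\<close>, bounded by periodicity, hence zero; time 0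
  recovers the given point.\<close>

lemma normal_equation_unique:
  fixes L :: "real ^ 'n::finite \<Rightarrow> real ^ 'n" and h k :: "'m::finite torus \<Rightarrow> real ^ 'n"
  assumes "linear L" "\<And>\<mu>. is_eigenvalue L \<mu> \<Longrightarrow> Re \<mu> \<noteq> 0" "torus_smooth h" "torus_smooth k"
    "\<And>\<phi>. dir_deriv \<omega> h \<phi> - L (h \<phi>) = dir_deriv \<omega> k \<phi> - L (k \<phi>)"
  shows "h = k"
proof
  fix \<phi> :: "'m torus"
  obtain x where \<phi>: "\<phi> = abs_torus x"
    by (rule torus_cases)
  define A where "A = complex_matrix L"
  obtain p where p: "p \<noteq> 0" "\<And>v. poly_apply A p v = 0"
      "\<And>\<mu>. poly p \<mu> = 0 \<Longrightarrow> \<exists>v. v \<noteq> 0 \<and> A *v v = \<mu> *s v"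
    using ex_annihilating_poly_roots_eigenvalues by blast
  have roots: "Re \<mu> \<noteq> 0" if "poly p \<mu> = 0" for \<mu>
    using p(3)[OF that] assms(2) unfolding is_eigenvalue_def A_def complex_matrix_def by blast
  define d where "d x = complexify (h (abs_torus x) - k (abs_torus x))" for x
  have hk: "smooth (\<lambda>x. h (abs_torus x))" "smooth (\<lambda>x. k (abs_torus x))"
    using assms(3,4) by (auto simp: torus_smooth_def)
  then have d: "smooth d" "torus_periodic d"
    unfolding d_def
    by (auto intro!: smooth_bounded_linear[OF bounded_linear_complexify] smooth_diff
        simp: torus_periodic_def simp flip: torus.abs_eq_iff)
  have Dd: "frechet_derivative d (at y) \<omega> = A *v d y" for y
  proof -
    have "frechet_derivative d (at y) \<omega>
        = complexify (dir_deriv \<omega> h (abs_torus y) - dir_deriv \<omega> k (abs_torus y))"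
      unfolding d_def
      by (simp only: frechet_derivative_bounded_linear[OF bounded_linear_complexify smooth_diff[OF hk]]
          frechet_derivative_diff[OF hk] dir_deriv_abs_torus assms(3,4))
    also have "dir_deriv \<omega> h (abs_torus y) - dir_deriv \<omega> k (abs_torus y)
        = L (h (abs_torus y) - k (abs_torus y))"
      using assms(5)[of "abs_torus y"] by (simp add: linear_diff[OF assms(1)] algebra_simps)
    finally show ?thesis
      unfolding A_def d_def complex_matrix_complexify[OF assms(1)] .
  qed
  obtain B where "\<And>x. norm (d x) \<le> B"
    using torus_periodic_bounded[OF d(2)] smooth_periodic_continuous[OF d(2,1)]
    unfolding periodic_continuous_def by metis
  then have "bounded (range (\<lambda>t. d (x + t *\<^sub>R \<omega>)))"
    unfolding bounded_iff by blast
  moreover have "((\<lambda>t. d (x + t *\<^sub>R \<omega>)) has_vector_derivative A *v d (x + t *\<^sub>R \<omega>)) (at t)" for t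
    using has_vector_derivative_along_line[OF d(1), of x \<omega> t UNIV] by (simp add: Dd)
  ultimately have "d (x + 0 *\<^sub>R \<omega>) = 0"
    by (intro bounded_solution_eq_zero[OF p(1) roots p(2), where x = "\<lambda>t. d (x + t *\<^sub>R \<omega>)"])
  then have "Re_vec (d x) = 0"
    by (simp add: Re_vec_def vec_eq_iff)
  then show "h \<phi> = k \<phi>"
    by (simp add: d_def \<phi>)
qed

theorem theorem4p4:
  fixes \<omega> :: "real ^ 'm"
    and L :: "real ^ 'n \<Rightarrow> real ^ 'n"
    and g\<^sub>j U\<^sub>j :: "'m torus \<Rightarrow> real ^ 'm"
    and V\<^sub>j :: "'m torus \<Rightarrow> real ^ 'n"
  assumes "linear L"
    and "\<And>\<mu>. is_eigenvalue L \<mu> \<Longrightarrow> Re \<mu> \<noteq> 0"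
    and "torus_smooth g\<^sub>j" and "torus_smooth U\<^sub>j" and "torus_smooth V\<^sub>j"
  shows "\<exists>!(f\<^sub>j :: 'm torus \<Rightarrow> real ^ 'm, h\<^sub>j :: 'm torus \<Rightarrow> real ^ 'n).
           torus_smooth f\<^sub>j \<and> torus_smooth h\<^sub>j \<and>
           (\<forall>\<phi>. dir_deriv \<omega> g\<^sub>j \<phi> + f\<^sub>j \<phi> = U\<^sub>j \<phi>) \<and>
           (\<forall>\<phi>. dir_deriv \<omega> h\<^sub>j \<phi> - L (h\<^sub>j \<phi>) = V\<^sub>j \<phi>)"
proof -
  obtain h where h: "torus_smooth h" "\<And>\<phi>. dir_deriv \<omega> h \<phi> - L (h \<phi>) = V\<^sub>j \<phi>"
    using normal_equation_solvable[OF assms(1,2,5)] by blast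
  have f: "torus_smooth (\<lambda>\<phi>. U\<^sub>j \<phi> - dir_deriv \<omega> g\<^sub>j \<phi>)"
    using torus_smooth_dir_deriv[OF assms(3), of \<omega>] assms(4)
    unfolding torus_smooth_def by (rule smooth_diff[rotated])
  \<comment> \<open>The equations are uncoupled: the first component is forced pointwise, the second
    by \<open>normal_equation_unique\<close>.\<close>
  show ?thesis
  proof (rule ex1I[of _ "(\<lambda>\<phi>. U\<^sub>j \<phi> - dir_deriv \<omega> g\<^sub>j \<phi>, h)"], goal_cases)
    case 1
    then show ?case
      using h f by simp
  next
    case (2 fh)
    obtain f' h' where fh: "fh = (f', h')" by fastforce
    have "f' = (\<lambda>\<phi>. U\<^sub>j \<phi> - dir_deriv \<omega> g\<^sub>j \<phi>)"
      using 2 unfolding fh by (auto simp: fun_eq_iff algebra_simps)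
    moreover have "h' = h"
      using 2 h unfolding fh by (intro normal_equation_unique[OF assms(1,2), where \<omega> = \<omega>]) auto
    ultimately show ?case
      by (simp add: fh)
  qed
qed

end
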